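(* Let $G_1$ and $G_2$ be looped simple graphs with vertices $v_1\in V(G_1)$ and $v_2\in V(G_2)$ that are either both unlooped or both looped, and let $G_1\vee G_2$ denote their one-point join at $v_1,v_2$. Then, as polynomials in $z$, \[ (4z^2-2z-2)\,T_{G_1\vee G_2}=\begin{bmatrix} T_{G_1} & T_{G_1+v_1} & T_{G_1-v_1} \end{bmatrix} \begin{bmatrix} -(z+1) & z & 2z^2 \\ z & -(z+1) & 2z^2 \\ 2z^2 & 2z^2 & -4z^2(z+1) \end{bmatrix} \begin{bmatrix} T_{G_2} \\ T_{G_2+v_2} \\ T_{G_2-v_2} \end{bmatrix}. \]
   Context: A looped simple graph is a graph with at most one edge between any two distinct vertices, where each vertex may carry at most one loop; its adjacency matrix $M$ over $\mathbb{F}_2$ has $M_{uv}=1$ iff $u\neq v$ are adjacent and $M_{vv}=1$ iff $v$ has a loop. For $S\subseteq V(G)$, $M[S]$ is the principal submatrix indexed by $S$ ($M[\emptyset]$ is considered nonsingular). The delta-matroid of $G$ is the set system $D(G)=(V(G),\mathcal{F})$ with $\mathcal{F}=\{S\subseteq V(G): M[S]\text{ nonsingular over }\mathbb{F}_2\}$. For a set system $D=(E,\mathcal{F})$ and $A\subseteq E$, the twist is $D*A=(E,\{X\triangle A: X\in\mathcal{F}\})$, and the width is $w(D)=\max\{|F|:F\in\mathcal{F}\}-\min\{|F|:F\in\mathcal{F}\}$. The twist polynomial is $T_D(z)=\sum_{A\subseteq E} z^{w(D*A)}$, and $T_G(z)=T_{D(G)}(z)$. For a vertex $v$, $G+v$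 is the loop complementation (add a loop at $v$ if $v$ is unlooped, remove it if looped) and $G-v$ is the graph with $v$ deleted. The one-point join $G_1\vee G_2$ of $(G_1,v_1)$ and $(G_2,v_2)$ (with $v_1,v_2$ of the same loop status) is the disjoint union of $G_1$ and $G_2$ with $v_1$ and $v_2$ identified. The twist polynomial of the graph with no vertices is $1$.
   Formalization: If v1 and v2 are both looped, their loops cancel in the join, so the identified vertex is unlooped; keeping one loop makes the formula false (two single looped vertices: it forces T = 2, but a looped vertex has T = 2z). The unlooped case is as stated. *)

theory Defs
  imports
    "HOL-Library.Z2"
    "HOL-Combinatorics.Permutations"
    "HOL-Computational_Algebra.Polynomial"
    "Jordan_Normal_Form.Matrix"
begin

text \<open>
  An edge between distinct vertices u and v is the set \<open>{u, v}\<close>, a loop at v is the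
  singleton \<open>{v}\<close>. So edges are undirected and cannot be repeated.
\<close>

record 'a graph =
  vertices :: "'a set"
  edges :: "'a set set"

definition looped_simple_graph :: "'a graph \<Rightarrow> bool" where
  "looped_simple_graph G \<longleftrightarrow>
     finite (vertices G) \<and>
     (\<forall>e\<in>edges G. \<exists>u\<in>vertices G. \<exists>v\<in>vertices G. e = {u, v})"

definition looped :: "'a graph \<Rightarrow> 'a \<Rightarrow> bool" where
  "looped G v \<longleftrightarrow> {v} \<in> edges G"

definition adjacency :: "'a graph \<Rightarrow> 'a \<Rightarrow> 'a \<Rightarrow> bit" where
  "adjacency G u v = (if {u, v} \<in> edges G then 1 else 0)"

text \<open>
  Library determinants are indexed by a finite type or by an initial segment of the
  naturals. This is the same Leibniz formula for the principal submatrix \<open>M[S]\<close> with rows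
  and columns indexed by the finite set S; for empty S it gives 1.
\<close>

definition principal_minor :: "('a \<Rightarrow> 'a \<Rightarrow> 'b::comm_ring_1) \<Rightarrow> 'a set \<Rightarrow> 'b" where
  "principal_minor M S =
     (\<Sum>p | p permutes S. of_int (sign p) * (\<Prod>i\<in>S. M i (p i)))"

text \<open>A set system is a pair of a ground set and a family of feasible subsets.\<close>

type_synonym 'a set_system = "'a set \<times> 'a set set"

definition delta_matroid :: "'a graph \<Rightarrow> 'a set_system" where
  "delta_matroid G =
     (vertices G, {S. S \<subseteq> vertices G \<and> principal_minor (adjacency G) S \<noteq> 0})"

definition twist :: "'a set_system \<Rightarrow> 'a set \<Rightarrow> 'a set_system" where
  "twist D A = (fst D, (\<lambda>X. sym_diff X A) ` snd D)"

definition width :: "'a set_system \<Rightarrow> nat" where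
  "width D = Max (card ` snd D) - Min (card ` snd D)"

definition twist_poly :: "'a set_system \<Rightarrow> int poly" where
  "twist_poly D = (\<Sum>A\<in>Pow (fst D). monom 1 (width (twist D A)))"

definition graph_twist_poly :: "'a graph \<Rightarrow> int poly" where
  "graph_twist_poly G = twist_poly (delta_matroid G)"

definition loop_complement :: "'a graph \<Rightarrow> 'a \<Rightarrow> 'a graph" where
  "loop_complement G v = G\<lparr>edges := sym_diff (edges G) {{v}}\<rparr>"

definition delete_vertex :: "'a graph \<Rightarrow> 'a \<Rightarrow> 'a graph" where
  "delete_vertex G v = \<lparr>vertices = vertices G - {v}, edges = {e \<in> edges G. v \<notin> e}\<rparr>"

text \<open>
  The disjoint union of G and H with v and w identified, the common point being \<open>Inl v\<close>.
  The two edge sets, placed on the common vertex set, can share only the loop \<open>{Inl v}\<close>,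
  which happens exactly when v and w are both looped. The identified vertex then receives
  two loops, while a looped simple graph admits at most one. Loops are counted modulo 2, as
  in loop complementation: the adjacency matrix over \<open>F\<^sub>2\<close> of the join is the sum of
  the two given ones (extended by 0), the entry at the common vertex is \<open>1 + 1 = 0\<close>, and
  that vertex is unlooped. If v and w are unlooped, the symmetric difference is the union.

  Keeping one loop instead would make the join formula false: for two one-vertex graphs with
  a loop, the twist polynomials of G, of G with the loop removed, and of G without its vertex
  are \<open>2z\<close>, \<open>2\<close> and \<open>1\<close>, and the right-hand side of the formula is \<open>8z^2 - 4z - 4\<close>; this is
  \<open>(4z^2 - 2z - 2) * 2\<close>, where 2 belongs to the unlooped vertex and \<open>2z\<close> to the looped one.
\<close>

definition one_point_join :: "'a graph \<Rightarrow> 'a \<Rightarrow> 'b graph \<Rightarrow> 'b \<Rightarrow> ('a + 'b) graph" where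
  "one_point_join G v H w =
     (let \<iota> = (\<lambda>y. if y = w then Inl v else Inr y)
      in \<lparr>vertices = Inl ` vertices G \<union> \<iota> ` vertices H,
          edges = sym_diff ((`) Inl ` edges G) ((`) \<iota> ` edges H)\<rparr>)"

end

theory Submission
  imports Defs "Jordan_Normal_Form.Determinant"
begin

text \<open>
  For a symmetric matrix M over \<open>F\<^sub>2\<close>, the distance from A to the nearest feasible set is the
  nullity of \<open>M[A]\<close>, so the width of \<open>D(G) * A\<close> is the rank of \<open>M[A]\<close> plus the rank of
  \<open>M[V - A]\<close>. Put \<open>W = V - {v}\<close>. Bordering \<open>M[A]\<close>, \<open>A \<subseteq> W\<close>, by the row and column of v raises
  the rank by 2 if that column is not in the image of \<open>M[A]\<close>, and otherwise by 0 or 1 according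
  to the Schur complement s in \<open>F\<^sub>2\<close>. Let P, \<open>P\<^sub>0\<close>, \<open>P\<^sub>1\<close> be the sums of
  \<open>z ^ (rank M[A] + rank M[W - A])\<close> over the sets A of these three kinds. The twist polynomials of
  G, \<open>G + v\<close> and \<open>G - v\<close> are \<open>2(z\<^sup>2 P + P\<^sub>0 + z P\<^sub>1)\<close>, \<open>2(z\<^sup>2 P + z P\<^sub>0 + P\<^sub>1)\<close> and
  \<open>P + P\<^sub>0 + P\<^sub>1\<close>. At a one-point join ranks add and Schur complements add in \<open>F\<^sub>2\<close>, which
  expresses the twist polynomial of the join bilinearly in the two triples.
\<close>

section \<open>Arithmetic in F_2 and solvability of linear systems\<close>

declare add_bit_eq_xor [simp del] mult_bit_eq_and [simp del]

lemma bit_add_self [simp]: "a + a = 0" "a + (a + b) = b" for a b :: bit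
  by (cases a; cases b; simp)+

lemma bit_add_eq_0_iff [simp]: "a + b = 0 \<longleftrightarrow> a = b" for a b :: bit
  by (cases a; cases b; simp)

text \<open>The Fredholm alternative, by Gaussian elimination with induction on the columns. It
  serves the case where the column of \<open>v\<close> is outside the image of \<open>M[A]\<close>:
  the second alternative then yields a functional separating that column from the image.\<close>

lemma linear_system_alternative:
  fixes N :: "'i \<Rightarrow> 'j \<Rightarrow> 'f::field"
  assumes "finite I" "finite J"
  shows "(\<exists>y. \<forall>i\<in>I. (\<Sum>j\<in>J. N i j * y j) = b i) \<or>
    (\<exists>k. (\<forall>j\<in>J. (\<Sum>i\<in>I. k i * N i j) = 0) \<and> (\<Sum>i\<in>I. k i * b i) \<noteq> 0)"
  using assms(2)
proof (induction J arbitrary: N b rule: finite_induct)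
  case empty
  show ?case
  proof (cases "\<forall>i\<in>I. b i = 0")
    case False
    then obtain p where p: "p \<in> I" "b p \<noteq> 0" by blast
    have "(\<Sum>i\<in>I. (if i = p then 1 else 0) * b i) = b p"
      using assms(1) p by (simp add: if_distrib[of "\<lambda>x. x * _"] cong: if_cong)
    then show ?thesis using p by (intro disjI2 exI[of _ "\<lambda>i. if i = p then 1 else 0"]) simp
  qed simp
next
  case (insert j J)
  show ?case
  proof (cases "\<forall>i\<in>I. N i j = 0")
    case True
    then show ?thesis using insert.IH[of N b] insert.hyps by simp
  next
    case False
    then obtain p where p: "p \<in> I" "N p j \<noteq> 0" by blast
    \<comment> \<open>Subtracting \<open>c i\<close> times row \<open>p\<close> from row
      \<open>i\<close> clears column \<open>j\<close>. Since \<open>c p = 1\<close>, row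
      \<open>p\<close> itself becomes zero, so the index set \<open>I\<close> can stay the same in
      the induction.\<close>
    define c where "c i = N i j / N p j" for i
    have cj: "c i * N p j = N i j" for i
      using p by (simp add: c_def)
    have "(\<exists>y. \<forall>i\<in>I. (\<Sum>l\<in>J. (N i l - c i * N p l) * y l) = b i - c i * b p) \<or>
      (\<exists>k. (\<forall>l\<in>J. (\<Sum>i\<in>I. k i * (N i l - c i * N p l)) = 0) \<and>
        (\<Sum>i\<in>I. k i * (b i - c i * b p)) \<noteq> 0)"
      by (rule insert.IH)
    then show ?thesis
    proof (elim disjE exE conjE)
      fix y assume y: "\<forall>i\<in>I. (\<Sum>l\<in>J. (N i l - c i * N p l) * y l) = b i - c i * b p"
      \<comment> \<open>Back substitution: the unknown at \<open>j\<close> is determined by row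
        \<open>p\<close>.\<close>
      define y' where "y' = y(j := (b p - (\<Sum>l\<in>J. N p l * y l)) / N p j)"
      have "(\<Sum>l\<in>insert j J. N i l * y' l) = b i" if "i \<in> I" for i
      proof -
        have "(\<Sum>l\<in>J. N i l * y' l) = (\<Sum>l\<in>J. N i l * y l)"
          using insert.hyps by (intro sum.cong) (auto simp: y'_def)
        moreover have "N i j * y' j = c i * (b p - (\<Sum>l\<in>J. N p l * y l))"
          by (simp add: y'_def c_def)
        moreover have "(\<Sum>l\<in>J. N i l * y l) = b i - c i * b p + c i * (\<Sum>l\<in>J. N p l * y l)"
          using y that
          by (simp add: left_diff_distrib sum_subtractf sum_distrib_left mult.assoc diff_eq_eq)
        ultimately show ?thesis using insert.hyps by (simp add: right_diff_distrib)
      qed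
      then show ?thesis by blast
    next
      fix k assume k: "\<forall>l\<in>J. (\<Sum>i\<in>I. k i * (N i l - c i * N p l)) = 0"
        and kb: "(\<Sum>i\<in>I. k i * (b i - c i * b p)) \<noteq> 0"
      \<comment> \<open>Combining the reduced rows with coefficients \<open>k\<close> uses row
        \<open>p\<close> an extra \<open>-(\<Sum>i\<in>I. k i * c i)\<close> times;
        \<open>k'\<close> expresses the same combination in the original rows.\<close>
      define k' where "k' i = k i - (if i = p then \<Sum>i\<in>I. k i * c i else 0)" for i
      have *: "(\<Sum>i\<in>I. k' i * g i) = (\<Sum>i\<in>I. k i * (g i - c i * g p))" for g
      proof -
        have "(\<Sum>i\<in>I. k' i * g i) = (\<Sum>i\<in>I. k i * g i) - (\<Sum>i\<in>I. k i * c i) * g p"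
          using assms(1) p
          by (simp add: k'_def left_diff_distrib sum_subtractf if_distrib[of "\<lambda>x. x * _"] cong: if_cong)
        then show ?thesis
          by (simp add: right_diff_distrib sum_subtractf sum_distrib_right mult.assoc)
      qed
      have "(\<Sum>i\<in>I. k' i * N i l) = 0" if "l \<in> insert j J" for l
        using that k by (auto simp: * cj)
      moreover have "(\<Sum>i\<in>I. k' i * b i) \<noteq> 0"
        using kb by (simp add: *)
      ultimately show ?thesis by blast
    qed
  qed
qed

section \<open>Ranks of principal submatrices over \<open>F\<^sub>2\<close>\<close>

definition symmetric :: "('a \<Rightarrow> 'a \<Rightarrow> 'b) \<Rightarrow> bool" where
  "symmetric M \<longleftrightarrow> (\<forall>i j. M i j = M j i)"

lemma symmetricD: "symmetric M \<Longrightarrow> M i j = M j i"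
  by (simp add: symmetric_def)

text \<open>The null space of \<open>M[A]\<close>, with vectors extended by 0 outside
  \<open>A\<close>. This makes it a finite set for finite \<open>A\<close> and lets kernels for
  different index sets be compared directly.\<close>

definition kernel_on :: "('a \<Rightarrow> 'a \<Rightarrow> bit) \<Rightarrow> 'a set \<Rightarrow> ('a \<Rightarrow> bit) set" where
  "kernel_on M A = {x. (\<forall>i. i \<notin> A \<longrightarrow> x i = 0) \<and> (\<forall>i\<in>A. (\<Sum>j\<in>A. M i j * x j) = 0)}"

text \<open>The Schur complement of \<open>M[A]\<close> in the matrix bordered by \<open>v\<close>.
  A solution \<open>y\<close> replaces the inverse of \<open>M[A]\<close> applied to the column of
  \<open>v\<close>, because \<open>M[A]\<close> may be singular; the usual minus sign disappears in
  characteristic 2.\<close>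

definition is_schur :: "('a \<Rightarrow> 'a \<Rightarrow> bit) \<Rightarrow> 'a \<Rightarrow> 'a set \<Rightarrow> bit \<Rightarrow> bool" where
  "is_schur M v A s \<longleftrightarrow> (\<exists>y. (\<forall>i\<in>A. (\<Sum>j\<in>A. M i j * y j) = M i v) \<and>
     s = M v v + (\<Sum>j\<in>A. M v j * y j))"

text \<open>\<open>None\<close> stands for a column of v outside the image of \<open>M[A]\<close>; the two tests exclude each
  other when M is symmetric.\<close>

definition schur :: "('a \<Rightarrow> 'a \<Rightarrow> bit) \<Rightarrow> 'a \<Rightarrow> 'a set \<Rightarrow> bit option" where
  "schur M v A =
     (if is_schur M v A 0 then Some 0 else if is_schur M v A 1 then Some 1 else None)"

text \<open>The dimension over F_2, recovered from the number of kernel vectors. For symmetric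
  \<open>M\<close> and finite \<open>A\<close> the description is justified by
  \<open>nullity_on_le_card_kernel_on\<close>.\<close>

definition nullity_on :: "('a \<Rightarrow> 'a \<Rightarrow> bit) \<Rightarrow> 'a set \<Rightarrow> nat" where
  "nullity_on M A = (THE n. card (kernel_on M A) = 2 ^ n)"

definition rank_on :: "('a \<Rightarrow> 'a \<Rightarrow> bit) \<Rightarrow> 'a set \<Rightarrow> nat" where
  "rank_on M A = card A - nullity_on M A"

definition rank_jump :: "bit option \<Rightarrow> nat" where
  "rank_jump t = (case t of None \<Rightarrow> 2 | Some s \<Rightarrow> if s = 0 then 0 else 1)"

lemma finite_kernel_on [simp]: "finite A \<Longrightarrow> finite (kernel_on M A)"
proof -
  assume "finite A"
  have "(UNIV :: bit set) = {0, 1}"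
    using bit_not_zero_iff by blast
  then have "finite (UNIV :: bit set)" by (metis finite.emptyI finite_insert)
  with \<open>finite A\<close> have "finite {f. \<forall>x. (x \<in> A \<longrightarrow> f x \<in> (UNIV :: bit set)) \<and> (x \<notin> A \<longrightarrow> f x = 0)}"
    by (rule finite_set_of_finite_funs)
  then show ?thesis
    by (rule rev_finite_subset) (auto simp: kernel_on_def)
qed

lemma zero_in_kernel_on [simp]: "(\<lambda>_. 0) \<in> kernel_on M A"
  by (simp add: kernel_on_def)

lemma kernel_on_add:
  "x \<in> kernel_on M A \<Longrightarrow> y \<in> kernel_on M A \<Longrightarrow> (\<lambda>i. x i + y i) \<in> kernel_on M A"
  by (simp add: kernel_on_def distrib_left sum.distrib)

text \<open>Translation by \<open>t\<close> is an involution of \<open>S\<close> that exchanges the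
  two fibres of \<open>f\<close>.\<close>

lemma card_additive_halving:
  fixes S :: "('a \<Rightarrow> bit) set" and f :: "('a \<Rightarrow> bit) \<Rightarrow> bit"
  assumes "finite S" "\<And>x y. x \<in> S \<Longrightarrow> y \<in> S \<Longrightarrow> (\<lambda>i. x i + y i) \<in> S"
    and f: "\<And>x y. f (\<lambda>i. x i + y i) = f x + f y"
    and t: "t \<in> S" "f t = 1"
  shows "card S = 2 * card {x \<in> S. f x = 0}"
proof -
  have "bij_betw (\<lambda>x i. t i + x i) {x \<in> S. f x = 0} {x \<in> S. f x = 1}"
    by (rule bij_betw_byWitness[where f' = "\<lambda>x i. t i + x i"])
      (auto simp: f t assms(2))
  then have "card {x \<in> S. f x = 0} = card {x \<in> S. f x = 1}"
    by (rule bij_betw_same_card)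
  moreover have "card S = card {x \<in> S. f x = 0} + card {x \<in> S. f x = 1}"
    using \<open>finite S\<close> by (subst card_Un_disjoint[symmetric]) (auto intro!: arg_cong[where f = card])
  ultimately show ?thesis by simp
qed

text \<open>By symmetry, if the column of \<open>v\<close> is \<open>M[A]\<close> applied to
  \<open>y\<close>, then the row of \<open>v\<close> is the transpose of \<open>y\<close> times
  \<open>M[A]\<close>. In particular that row annihilates the kernel of \<open>M[A]\<close>.\<close>

lemma is_schur_orthogonal:
  fixes M :: "'a \<Rightarrow> 'a \<Rightarrow> 'b::comm_semiring_0"
  assumes sym: "symmetric M"
    and y: "\<forall>i\<in>A. (\<Sum>j\<in>A. M i j * y j) = M i v"
  shows "(\<Sum>j\<in>A. M v j * x j) = (\<Sum>i\<in>A. y i * (\<Sum>j\<in>A. M i j * x j))"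
proof -
  have "(\<Sum>j\<in>A. M v j * x j) = (\<Sum>j\<in>A. (\<Sum>i\<in>A. M j i * y i) * x j)"
    by (rule sum.cong) (use y symmetricD[OF sym, of v] in auto)
  also have "\<dots> = (\<Sum>j\<in>A. \<Sum>i\<in>A. y i * (M i j * x j))"
    unfolding sum_distrib_right by (intro sum.cong refl)
      (simp only: symmetricD[OF sym] ac_simps)
  also have "\<dots> = (\<Sum>i\<in>A. \<Sum>j\<in>A. y i * (M i j * x j))"
    by (rule sum.swap)
  finally show ?thesis by (simp add: sum_distrib_left)
qed

text \<open>The Schur complement does not depend on the chosen solution: for solutions
  \<open>y\<close> and \<open>z\<close>, the row of \<open>v\<close> applied to either one is the
  value of the symmetric form \<open>M[A]\<close> at \<open>z\<close> and \<open>y\<close>.\<close>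

lemma is_schur_unique:
  assumes sym: "symmetric M" and "is_schur M v A s" "is_schur M v A t"
  shows "s = t"
proof -
  obtain y where y: "\<forall>i\<in>A. (\<Sum>j\<in>A. M i j * y j) = M i v" "s = M v v + (\<Sum>j\<in>A. M v j * y j)"
    using assms(2) unfolding is_schur_def by blast
  obtain z where z: "\<forall>i\<in>A. (\<Sum>j\<in>A. M i j * z j) = M i v" "t = M v v + (\<Sum>j\<in>A. M v j * z j)"
    using assms(3) unfolding is_schur_def by blast
  have "(\<Sum>j\<in>A. M v j * y j) = (\<Sum>i\<in>A. z i * M i v)"
    unfolding is_schur_orthogonal[OF sym z(1)] using y(1) by (intro sum.cong) auto
  also have "\<dots> = (\<Sum>j\<in>A. M v j * z j)"
    by (intro sum.cong) (auto simp: symmetricD[OF sym, of v] mult.commute)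
  finally show ?thesis using y(2) z(2) by simp
qed

lemma schur_eq_Some_iff:
  assumes sym: "symmetric M"
  shows "schur M v A = Some s \<longleftrightarrow> is_schur M v A s"
  using is_schur_unique[OF sym, of v A] by (cases s) (auto simp: schur_def)

lemma kernel_on_insert_iff:
  assumes "finite A" "v \<notin> A"
  shows "x \<in> kernel_on M (insert v A) \<longleftrightarrow>
    (\<forall>i. i \<noteq> v \<and> i \<notin> A \<longrightarrow> x i = 0) \<and> M v v * x v = (\<Sum>j\<in>A. M v j * x j) \<and>
    (\<forall>i\<in>A. M i v * x v = (\<Sum>j\<in>A. M i j * x j))"
  using assms by (auto simp: kernel_on_def)

lemma kernel_on_insert_zero:
  assumes "finite A" "v \<notin> A"
  shows "{x \<in> kernel_on M (insert v A). x v = 0} =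
    {x \<in> kernel_on M A. (\<Sum>j\<in>A. M v j * x j) = 0}"
  using assms by (auto simp: kernel_on_insert_iff) (auto simp: kernel_on_def)

text \<open>A kernel vector of the bordered matrix with entry 1 at \<open>v\<close> restricts on
  \<open>A\<close> to a solution for the column of \<open>v\<close>, and its equation in row
  \<open>v\<close> says that the Schur complement vanishes.\<close>

lemma ex_kernel_on_insert_iff:
  assumes "finite A" "v \<notin> A"
  shows "(\<exists>x\<in>kernel_on M (insert v A). x v = 1) \<longleftrightarrow> is_schur M v A 0"
proof
  assume "\<exists>x\<in>kernel_on M (insert v A). x v = 1"
  then show "is_schur M v A 0"
    using assms by (auto simp: kernel_on_insert_iff is_schur_def)
next
  assume "is_schur M v A 0"
  then obtain y where y: "\<forall>i\<in>A. (\<Sum>j\<in>A. M i j * y j) = M i v" "M v v = (\<Sum>j\<in>A. M v j * y j)"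
    unfolding is_schur_def by (metis bit_add_eq_0_iff)
  define x where "x i = (if i = v then 1 else if i \<in> A then y i else 0)" for i
  have "(\<Sum>j\<in>A. M i j * x j) = (\<Sum>j\<in>A. M i j * y j)" for i
    using assms by (intro sum.cong) (auto simp: x_def)
  then have "x \<in> kernel_on M (insert v A)"
    using assms y by (auto simp: kernel_on_insert_iff) (auto simp: x_def)
  then show "\<exists>x\<in>kernel_on M (insert v A). x v = 1"
    by (intro bexI[of _ x]) (auto simp: x_def)
qed

text \<open>Split the kernel of the bordered matrix by the entry at \<open>v\<close>. Entry 0 gives
  the vectors of the kernel of \<open>M[A]\<close> annihilated by the row of \<open>v\<close>: all
  of them if the column of \<open>v\<close> lies in the image, half of them otherwise. Entry 1
  occurs only for Schur complement 0, and then doubles the count.\<close>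

lemma card_kernel_on_insert:
  assumes sym: "symmetric M" and "finite A" "v \<notin> A"
  shows "schur M v A = Some 0 \<Longrightarrow> card (kernel_on M (insert v A)) = 2 * card (kernel_on M A)"
    and "schur M v A = Some 1 \<Longrightarrow> card (kernel_on M (insert v A)) = card (kernel_on M A)"
    and "schur M v A = None \<Longrightarrow> 2 * card (kernel_on M (insert v A)) = card (kernel_on M A)"
proof -
  have orth: "{x \<in> kernel_on M A. (\<Sum>j\<in>A. M v j * x j) = 0} = kernel_on M A"
    if "is_schur M v A s" for s
  proof -
    from that obtain y where y: "\<forall>i\<in>A. (\<Sum>j\<in>A. M i j * y j) = M i v"
      unfolding is_schur_def by blast
    show ?thesis using is_schur_orthogonal[OF sym y] by (auto simp: kernel_on_def)
  qed
  have zero: "kernel_on M (insert v A) = {x \<in> kernel_on M A. (\<Sum>j\<in>A. M v j * x j) = 0}"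
    if "\<not> is_schur M v A 0"
  proof -
    have "kernel_on M (insert v A) = {x \<in> kernel_on M (insert v A). x v = 0}"
      using that ex_kernel_on_insert_iff[OF assms(2,3)] bit_not_zero_iff by blast
    then show ?thesis using kernel_on_insert_zero[OF assms(2,3)] by metis
  qed
  show "card (kernel_on M (insert v A)) = 2 * card (kernel_on M A)" if "schur M v A = Some 0"
  proof -
    have s: "is_schur M v A 0" using that by (simp add: schur_eq_Some_iff[OF sym])
    then obtain t where "t \<in> kernel_on M (insert v A)" "t v = 1"
      using ex_kernel_on_insert_iff[OF assms(2,3)] by blast
    then have "card (kernel_on M (insert v A)) = 2 * card {x \<in> kernel_on M (insert v A). x v = 0}"
      using assms by (intro card_additive_halving[where t = t and f = "\<lambda>x. x v"]) (auto intro: kernel_on_add)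
    then show ?thesis
      by (simp add: kernel_on_insert_zero[OF assms(2,3)] orth[OF s])
  qed
  show "card (kernel_on M (insert v A)) = card (kernel_on M A)" if "schur M v A = Some 1"
  proof -
    have "is_schur M v A 1" "\<not> is_schur M v A 0"
      using that by (auto simp: schur_def split: if_splits)
    then show ?thesis by (simp add: zero orth)
  qed
  show "2 * card (kernel_on M (insert v A)) = card (kernel_on M A)" if "schur M v A = None"
  proof -
    have no: "\<not> is_schur M v A s" for s
      using that schur_eq_Some_iff[OF sym, of v A s] by simp
    then have "\<not> (\<exists>y. \<forall>i\<in>A. (\<Sum>j\<in>A. M i j * y j) = M i v)"
      unfolding is_schur_def by blast
    with linear_system_alternative[OF assms(2) assms(2), of M "\<lambda>i. M i v"]
    obtain k where k: "\<forall>j\<in>A. (\<Sum>i\<in>A. k i * M i j) = 0" "(\<Sum>i\<in>A. k i * M i v) = 1"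
      by auto
    \<comment> \<open>By symmetry the separating combination \<open>k\<close> becomes a kernel
      vector \<open>t\<close> of \<open>M[A]\<close> on which the row of \<open>v\<close> takes the
      value 1, so this row cuts the kernel in half.\<close>
    define t where "t i = (if i \<in> A then k i else 0)" for i
    have *: "(\<Sum>j\<in>A. M i j * t j) = (\<Sum>j\<in>A. k j * M j i)" for i
      by (intro sum.cong) (auto simp: t_def symmetricD[OF sym, of i] mult.commute)
    have "t \<in> kernel_on M A"
      using k(1) unfolding kernel_on_def by (simp add: *) (simp add: t_def)
    moreover have "(\<Sum>j\<in>A. M v j * t j) = 1"
      using k(2) by (simp add: *)
    ultimately have "card (kernel_on M A) = 2 * card {x \<in> kernel_on M A. (\<Sum>j\<in>A. M v j * x j) = 0}"
      using assms(2)
      by (intro card_additive_halving[where t = t and f = "\<lambda>x. \<Sum>j\<in>A. M v j * x j"])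
        (auto intro: kernel_on_add simp: distrib_left sum.distrib)
    then show ?thesis using zero[OF no] by simp
  qed
qed

lemma nullity_onI: "card (kernel_on M A) = 2 ^ n \<Longrightarrow> nullity_on M A = n"
  unfolding nullity_on_def by (rule the_equality) auto

text \<open>Adding one index doubles, keeps or halves the number of kernel vectors, starting from 1
  for the empty set.\<close>

lemma nullity_on_le_card_kernel_on:
  assumes sym: "symmetric M" and "finite A"
  shows "nullity_on M A \<le> card A \<and> card (kernel_on M A) = 2 ^ nullity_on M A"
proof -
  have "\<exists>n\<le>card A. card (kernel_on M A) = 2 ^ n"
    using assms(2)
  proof induction
    case empty
    have "kernel_on M {} = {\<lambda>_. 0}" by (auto simp: kernel_on_def)
    then show ?case by auto
  next
    case (insert v A)
    then obtain n where n: "n \<le> card A" "card (kernel_on M A) = 2 ^ n" by blast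
    note step = card_kernel_on_insert[OF sym insert.hyps]
    have "schur M v A = None \<or> schur M v A = Some 0 \<or> schur M v A = Some 1"
      by (auto simp: schur_def)
    then show ?case
    proof (elim disjE)
      assume "schur M v A = None"
      then have 2: "2 * card (kernel_on M (insert v A)) = 2 ^ n" using step(3) n by simp
      \<comment> \<open>\<open>n = 0\<close> is excluded by parity.\<close>
      then obtain m where "n = Suc m" by (cases n) auto
      with 2 n insert.hyps show ?thesis by (intro exI[of _ m]) auto
    next
      assume "schur M v A = Some 0"
      then show ?thesis using step(1) n insert.hyps by (intro exI[of _ "Suc n"]) auto
    next
      assume "schur M v A = Some 1"
      then show ?thesis using step(2) n insert.hyps by (intro exI[of _ n]) auto
    qed
  qed
  then show ?thesis using nullity_onI by blast
qed

lemmas nullity_on_le_card = nullity_on_le_card_kernel_on[THEN conjunct1]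
lemmas card_kernel_on = nullity_on_le_card_kernel_on[THEN conjunct2]

text \<open>The kernel counts compared by exponents of 2. The equation is additive because the
  nullity drops by 1 when the jump is 2.\<close>

lemma nullity_on_insert:
  assumes sym: "symmetric M" and "finite A" "v \<notin> A"
  shows "nullity_on M (insert v A) + rank_jump (schur M v A) = nullity_on M A + 1"
proof -
  note step = card_kernel_on_insert[OF assms]
  have c: "card (kernel_on M A) = 2 ^ nullity_on M A"
    "card (kernel_on M (insert v A)) = 2 ^ nullity_on M (insert v A)"
    using card_kernel_on[OF sym] assms(2) by auto
  have "schur M v A = None \<or> schur M v A = Some 0 \<or> schur M v A = Some 1"
    by (auto simp: schur_def)
  then show ?thesis
  proof (elim disjE)
    assume *: "schur M v A = None"
    then have "(2::nat) ^ Suc (nullity_on M (insert v A)) = 2 ^ nullity_on M A"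
      using step(3) c by simp
    then have "Suc (nullity_on M (insert v A)) = nullity_on M A"
      by (rule power_inject_exp[THEN iffD1, rotated]) simp
    then show ?thesis by (simp add: * rank_jump_def)
  next
    assume *: "schur M v A = Some 0"
    then have "(2::nat) ^ nullity_on M (insert v A) = 2 ^ Suc (nullity_on M A)"
      using step(1) c by simp
    then have "nullity_on M (insert v A) = Suc (nullity_on M A)"
      by (rule power_inject_exp[THEN iffD1, rotated]) simp
    then show ?thesis by (simp add: * rank_jump_def)
  next
    assume *: "schur M v A = Some 1"
    then show ?thesis using step(2) c by (simp add: rank_jump_def)
  qed
qed

lemma rank_on_insert:
  assumes sym: "symmetric M" and "finite A" "v \<notin> A"
  shows "rank_on M (insert v A) = rank_on M A + rank_jump (schur M v A)"
  using nullity_on_insert[OF assms] nullity_on_le_card[OF sym assms(2)]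
    nullity_on_le_card[OF sym, of "insert v A"] assms(2,3)
  by (simp add: rank_on_def)

lemma kernel_on_cong:
  assumes "\<And>i j. i \<in> A \<Longrightarrow> j \<in> A \<Longrightarrow> M i j = N i j"
  shows "kernel_on M A = kernel_on N A"
  using assms by (auto simp: kernel_on_def)

lemma rank_on_cong:
  assumes "\<And>i j. i \<in> A \<Longrightarrow> j \<in> A \<Longrightarrow> M i j = N i j"
  shows "rank_on M A = rank_on N A"
  using kernel_on_cong[of A M N] assms by (simp add: rank_on_def nullity_on_def)

lemma nullity_on_eq_0_iff:
  assumes sym: "symmetric M" and "finite A"
  shows "nullity_on M A = 0 \<longleftrightarrow> kernel_on M A = {\<lambda>_. 0}"
proof
  assume "nullity_on M A = 0"
  then have "card (kernel_on M A) = 1" using card_kernel_on[OF assms] by simp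
  then obtain z where "kernel_on M A = {z}" by (auto simp: card_1_singleton_iff)
  then show "kernel_on M A = {\<lambda>_. 0}" using zero_in_kernel_on[of M A] by auto
qed (simp add: nullity_onI)

text \<open>If some kernel vector of \<open>M[A]\<close> has entry 1 at \<open>v\<close>, deleting
  \<open>v\<close> lowers the nullity by exactly 1, since the Schur complement over the remaining
  indices is 0. Repeating this reaches a nonsingular submatrix after as many deletions as the
  nullity of \<open>M[A]\<close>.\<close>

lemma ex_nonsingular_subset:
  assumes sym: "symmetric M" and "finite A"
  shows "\<exists>F\<subseteq>A. nullity_on M F = 0 \<and> card (A - F) = nullity_on M A"
  using assms(2)
proof (induction "card A" arbitrary: A)
  case 0
  then show ?case using nullity_on_le_card[OF sym, of A] by (intro exI[of _ A]) auto
next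
  case (Suc n)
  show ?case
  proof (cases "nullity_on M A = 0")
    case False
    then have "kernel_on M A \<noteq> {\<lambda>_. 0}" using nullity_on_eq_0_iff[OF sym Suc.prems] by simp
    then obtain x where x: "x \<in> kernel_on M A" "x \<noteq> (\<lambda>_. 0)"
      using zero_in_kernel_on[of M A] by blast
    then obtain v where "x v = 1" by (auto simp: fun_eq_iff)
    then have v: "v \<in> A" using x by (auto simp: kernel_on_def)
    define B where "B = A - {v}"
    have B: "A = insert v B" "v \<notin> B" "finite B" using v Suc.prems by (auto simp: B_def)
    have "is_schur M v B 0"
      using ex_kernel_on_insert_iff[OF B(3,2), of M] x \<open>x v = 1\<close> B(1) by blast
    then have "nullity_on M A = nullity_on M B + 1"
      using nullity_on_insert[OF sym B(3,2)] by (simp add: B(1) schur_def rank_jump_def)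
    moreover have "n = card B" using Suc.hyps(2) B by simp
    then obtain F where "F \<subseteq> B" "nullity_on M F = 0" "card (B - F) = nullity_on M B"
      using Suc.hyps(1)[of B] B(3) by blast
    moreover then have "card (A - F) = Suc (card (B - F))"
      using B by (subst B(1), subst insert_Diff_if) auto
    ultimately show ?thesis using B(1) by (intro exI[of _ F]) auto
  qed (auto intro: exI[of _ A])
qed

text \<open>Adding or removing one index changes the nullity by at most 1; the induction moves
  \<open>F\<close> towards \<open>A\<close> one element at a time. With \<open>F\<close> nonsingular
  this bounds the distance from \<open>A\<close> to a feasible set from below.\<close>

lemma nullity_on_diff_le:
  assumes sym: "symmetric M" and "finite A" "finite F"
  shows "nullity_on M A \<le> nullity_on M F + card (sym_diff F A)"
  using assms(3)
proof (induction "card (sym_diff F A)" arbitrary: F)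
  case 0
  then show ?case using assms(2) by auto
next
  case (Suc n)
  then obtain v where v: "v \<in> sym_diff F A"
    by (metis card.empty ex_in_conv nat.distinct(1))
  have step: "nullity_on M B \<le> nullity_on M (insert v B) + 1 \<and> nullity_on M (insert v B) \<le> nullity_on M B + 1"
    if "v \<notin> B" "finite B" for B
    using nullity_on_insert[OF sym that(2,1)]
    by (auto simp: rank_jump_def split: option.splits if_splits)
  show ?case
  proof (cases "v \<in> F")
    case True
    define B where "B = F - {v}"
    have B: "F = insert v B" "v \<notin> B" "finite B" using True Suc.prems by (auto simp: B_def)
    have "sym_diff F A = insert v (sym_diff B A)" "v \<notin> sym_diff B A" using v True B by auto
    then have c: "card (sym_diff F A) = Suc (card (sym_diff B A))"
      using B(3) assms(2) by simp
    then have "nullity_on M A \<le> nullity_on M B + card (sym_diff B A)"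
      using Suc.hyps B(3) by simp
    then show ?thesis using c step[OF B(2,3)] B(1) by simp
  next
    case False
    have "sym_diff F A = insert v (sym_diff (insert v F) A)" "v \<notin> sym_diff (insert v F) A"
      using v False by auto
    then have c: "card (sym_diff F A) = Suc (card (sym_diff (insert v F) A))"
      using Suc.prems assms(2) by (metis card_insert_disjoint finite_Diff finite_UnI finite_insert)
    then have "nullity_on M A \<le> nullity_on M (insert v F) + card (sym_diff (insert v F) A)"
      using Suc.hyps Suc.prems by simp
    then show ?thesis using c step[OF False Suc.prems] by simp
  qed
qed

section \<open>Widths of twists\<close>

text \<open>Signs equal 1 in characteristic 2, so only the relabelling of \<open>S\<close> by
  \<open>h\<close> has to be carried through the Leibniz formula.\<close>

lemma principal_minor_bit_eq_det:
  fixes M :: "'a \<Rightarrow> 'a \<Rightarrow> bit"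
  assumes h: "bij_betw h {0..<n} S"
  shows "principal_minor M S = det (mat n n (\<lambda>(i, j). M (h i) (h j)))"
proof -
  \<comment> \<open>\<open>?F q\<close> is the permutation \<open>q\<close> conjugated by
    \<open>h\<close>, extended by the identity outside \<open>S\<close>.\<close>
  let ?F = "\<lambda>q x. if x \<in> S then h (q (inv_into {0..<n} h x)) else x"
  have sgn: "of_int (sign p) = (1 :: bit)" for p :: "'c \<Rightarrow> 'c"
    by (simp add: sign_def)
  have "principal_minor M S = (\<Sum>q | q permutes {0..<n}. \<Prod>i\<in>S. M i (?F q i))"
    unfolding principal_minor_def sgn
    by (simp add: sum.reindex_bij_betw[OF bij_betw_permutations[OF h], symmetric])
  also have "\<dots> = (\<Sum>q | q permutes {0..<n}. \<Prod>k=0..<n. M (h k) (h (q k)))"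
  proof (intro sum.cong refl)
    fix q
    have "(\<Prod>i\<in>S. M i (?F q i)) = (\<Prod>k=0..<n. M (h k) (?F q (h k)))"
      by (rule prod.reindex_bij_betw[OF h, symmetric])
    also have "\<dots> = (\<Prod>k=0..<n. M (h k) (h (q k)))"
      using h by (intro prod.cong refl) (auto simp: bij_betw_def)
    finally show "(\<Prod>i\<in>S. M i (?F q i)) = (\<Prod>k=0..<n. M (h k) (h (q k)))" .
  qed
  also have "\<dots> = det (mat n n (\<lambda>(i, j). M (h i) (h j)))"
    unfolding det_def'[OF mat_carrier] sgn
    by (intro sum.cong refl prod.cong) (auto dest: permutes_in_image)
  finally show ?thesis .
qed

text \<open>A square matrix over a field is singular iff it kills a nonzero vector; \<open>h\<close>
  translates between vectors of length \<open>n\<close> and functions supported on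
  \<open>S\<close>.\<close>

lemma principal_minor_bit_eq_0_iff:
  fixes M :: "'a \<Rightarrow> 'a \<Rightarrow> bit"
  assumes "finite S"
  shows "principal_minor M S = 0 \<longleftrightarrow> kernel_on M S \<noteq> {\<lambda>_. 0}"
proof -
  define n where "n = card S"
  obtain h where h: "bij_betw h {0..<n} S"
    using ex_bij_betw_nat_finite[OF assms] n_def by blast
  define A where "A = mat n n (\<lambda>(i, j). M (h i) (h j))"
  have A: "A \<in> carrier_mat n n" by (simp add: A_def)
  have row: "(A *\<^sub>v v) $ k = (\<Sum>j\<in>S. M (h k) j * x j)"
    if "k < n" "v \<in> carrier_vec n" "\<And>l. l < n \<Longrightarrow> v $ l = x (h l)" for v k x
  proof -
    have "(\<Sum>j\<in>S. M (h k) j * x j) = (\<Sum>l=0..<n. M (h k) (h l) * x (h l))"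
      by (rule sum.reindex_bij_betw[OF h, symmetric])
    then show ?thesis using that by (auto simp: A_def scalar_prod_def intro!: sum.cong)
  qed
  have inj: "inv_into {0..<n} h (h l) = l" if "l < n" for l
    using h that by (simp add: bij_betw_def)
  have hS: "h l \<in> S" if "l < n" for l
    using h that by (auto simp: bij_betw_def)
  have surj: "\<exists>l<n. i = h l" if "i \<in> S" for i
    using h that by (auto simp: bij_betw_def)
  have "det A = 0 \<longleftrightarrow> kernel_on M S \<noteq> {\<lambda>_. 0}"
  proof
    assume "det A = 0"
    then obtain v where v: "v \<in> carrier_vec n" "v \<noteq> 0\<^sub>v n" "A *\<^sub>v v = 0\<^sub>v n"
      using det_0_iff_vec_prod_zero_field[OF A] by blast
    define x where "x i = (if i \<in> S then v $ inv_into {0..<n} h i else 0)" for i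
    have vx: "v $ l = x (h l)" if "l < n" for l
      using that inj hS by (simp add: x_def)
    have "(\<Sum>j\<in>S. M i j * x j) = 0" if "i \<in> S" for i
      using surj[OF that] row[OF _ v(1) vx] v(3) by auto
    then have "x \<in> kernel_on M S" by (auto simp: kernel_on_def x_def)
    moreover obtain l where "l < n" "v $ l \<noteq> 0"
      using v(1,2) by (metis carrier_vecD eq_vecI index_zero_vec)
    then have "x \<noteq> (\<lambda>_. 0)" using vx by (auto simp: fun_eq_iff)
    ultimately show "kernel_on M S \<noteq> {\<lambda>_. 0}" by blast
  next
    assume "kernel_on M S \<noteq> {\<lambda>_. 0}"
    then obtain x where x: "x \<in> kernel_on M S" "x \<noteq> (\<lambda>_. 0)"
      using zero_in_kernel_on[of M S] by blast
    define v where "v = vec n (\<lambda>l. x (h l))"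
    have v: "v \<in> carrier_vec n" by (simp add: v_def)
    have "(A *\<^sub>v v) $ k = 0" if "k < n" for k
      using row[OF that v, of x] x(1) hS[OF that] by (auto simp: v_def kernel_on_def)
    then have "A *\<^sub>v v = 0\<^sub>v n" using A by (intro eq_vecI) auto
    moreover have "v \<noteq> 0\<^sub>v n"
    proof -
      obtain i where "x i \<noteq> 0" using x(2) by (auto simp: fun_eq_iff)
      moreover from this have "i \<in> S" using x(1) by (auto simp: kernel_on_def)
      ultimately obtain l where l: "l < n" "x (h l) \<noteq> 0" using surj[of i] by metis
      from l show ?thesis by (metis index_vec index_zero_vec(1) v_def)
    qed
    ultimately show "det A = 0" using det_0_iff_vec_prod_zero_field[OF A] v by blast
  qed
  then show ?thesis using principal_minor_bit_eq_det[OF h] A_def by metis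
qed

text \<open>The two symmetric differences are complementary in \<open>V\<close>. Hence the largest
  distance from \<open>A\<close> to a feasible set is \<open>card V\<close> minus the smallest
  distance from \<open>V - A\<close>.\<close>

lemma card_sym_diff_compl:
  assumes "finite V" "X \<subseteq> V" "A \<subseteq> V"
  shows "card (sym_diff X A) + card (sym_diff X (V - A)) = card V"
proof -
  have "finite (sym_diff X A)" "finite (sym_diff X (V - A))"
    using assms finite_subset by blast+
  then show ?thesis
    using assms by (subst card_Un_disjoint[symmetric]) (auto intro!: arg_cong[where f = card])
qed

lemma symmetric_adjacency: "symmetric (adjacency G)"
  by (simp add: symmetric_def adjacency_def insert_commute)

text \<open>The smallest feasible set of the twist has size the nullity of \<open>M[A]\<close>:
  \<open>near\<close> attains this value and \<open>far\<close> bounds it. Passing to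
  \<open>V - A\<close> gives the largest size as \<open>card V\<close> minus the nullity of
  \<open>M[V - A]\<close>, and the difference is a sum of two ranks.\<close>

lemma width_twist_delta_matroid:
  assumes fin: "finite (vertices G)" and A: "A \<subseteq> vertices G"
  shows "width (twist (delta_matroid G) A) =
    rank_on (adjacency G) A + rank_on (adjacency G) (vertices G - A)"
proof -
  let ?M = "adjacency G" and ?V = "vertices G"
  define F where "F = {S. S \<subseteq> ?V \<and> nullity_on ?M S = 0}"
  note sym = symmetric_adjacency[of G]
  have finS: "finite S" if "S \<subseteq> ?V" for S using that fin by (rule finite_subset)
  have feas: "snd (delta_matroid G) = F"
    unfolding F_def delta_matroid_def snd_conv
    by (intro Collect_cong conj_cong refl)
      (metis finS nullity_on_eq_0_iff[OF sym] principal_minor_bit_eq_0_iff)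
  have "finite F" unfolding F_def using fin by simp
  define I where "I = (\<lambda>X. card (sym_diff X A)) ` F"
  have "finite I" using \<open>finite F\<close> by (simp add: I_def)
  have I: "card ` snd (twist (delta_matroid G) A) = I"
    by (simp add: twist_def feas I_def image_image)
  have near: "\<exists>X\<in>F. card (sym_diff X B) = nullity_on ?M B" if B: "B \<subseteq> ?V" for B
  proof -
    obtain X where X: "X \<subseteq> B" "nullity_on ?M X = 0" "card (B - X) = nullity_on ?M B"
      using ex_nonsingular_subset[OF sym finS[OF B]] by blast
    moreover have "sym_diff X B = B - X" using X by auto
    ultimately show ?thesis using B by (intro bexI[of _ X]) (auto simp: F_def)
  qed
  have far: "nullity_on ?M B \<le> card (sym_diff X B)" if "X \<in> F" "B \<subseteq> ?V" for X B
    using nullity_on_diff_le[OF sym finS finS, of B X] that by (auto simp: F_def)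
  have "Min I = nullity_on ?M A"
  proof (rule Min_eqI[OF \<open>finite I\<close>])
    show "nullity_on ?M A \<in> I" using near[OF A] by (force simp: I_def)
  qed (use far A in \<open>auto simp: I_def\<close>)
  moreover have "Max I = card ?V - nullity_on ?M (?V - A)"
  proof (rule Max_eqI[OF \<open>finite I\<close>])
    fix y assume "y \<in> I"
    then obtain X where X: "X \<in> F" "y = card (sym_diff X A)" by (auto simp: I_def)
    then have "y + card (sym_diff X (?V - A)) = card ?V"
      using card_sym_diff_compl[OF fin _ A] by (auto simp: F_def)
    then show "y \<le> card ?V - nullity_on ?M (?V - A)"
      using far[OF X(1), of "?V - A"] by simp
  next
    obtain X where X: "X \<in> F" "card (sym_diff X (?V - A)) = nullity_on ?M (?V - A)"
      using near[of "?V - A"] by auto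
    then have "card (sym_diff X A) + nullity_on ?M (?V - A) = card ?V"
      using card_sym_diff_compl[OF fin _ A, of X] by (auto simp: F_def)
    then have "card ?V - nullity_on ?M (?V - A) = card (sym_diff X A)" by simp
    then show "card ?V - nullity_on ?M (?V - A) \<in> I"
      unfolding I_def using X(1) by (rule image_eqI)
  qed
  moreover have "card ?V = card A + card (?V - A)"
    using A fin by (simp add: card_Diff_subset finS card_mono)
  ultimately show ?thesis
    using nullity_on_le_card[OF sym finS[OF A]] nullity_on_le_card[OF sym finS[of "?V - A"]]
    by (simp add: width_def I rank_on_def)
qed

section \<open>Rank generating polynomials sorted by Schur complement\<close>

definition rank_weight :: "('a \<Rightarrow> 'a \<Rightarrow> bit) \<Rightarrow> 'a set \<Rightarrow> 'a set \<Rightarrow> int poly" where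
  "rank_weight M V A = monom 1 (rank_on M A + rank_on M (V - A))"

text \<open>With \<open>V\<close> the vertex set without \<open>v\<close>, the values at
  \<open>None\<close>, \<open>Some 0\<close> and \<open>Some 1\<close> are the sums
  \<open>P\<close>, \<open>P\<^sub>0\<close> and \<open>P\<^sub>1\<close>.\<close>

definition schur_class_poly :: "('a \<Rightarrow> 'a \<Rightarrow> bit) \<Rightarrow> 'a set \<Rightarrow> 'a \<Rightarrow> bit option \<Rightarrow> int poly" where
  "schur_class_poly M V v t = (\<Sum>A | A \<in> Pow V \<and> schur M v A = t. rank_weight M V A)"

lemma sum_rank_weight_by_schur:
  assumes "finite V"
  shows "(\<Sum>A\<in>Pow V. rank_weight M V A * g (schur M v A)) =
    schur_class_poly M V v None * g None + schur_class_poly M V v (Some 0) * g (Some 0) +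
    schur_class_poly M V v (Some 1) * g (Some 1)"
proof -
  have "schur M v ` Pow V \<subseteq> {None, Some 0, Some 1}"
    by (auto simp: schur_def)
  then have "(\<Sum>A\<in>Pow V. rank_weight M V A * g (schur M v A)) =
    (\<Sum>t\<in>{None, Some 0, Some 1}. \<Sum>A | A \<in> Pow V \<and> schur M v A = t. rank_weight M V A * g (schur M v A))"
    using assms by (intro sum.group[symmetric]) auto
  also have "\<dots> = (\<Sum>t\<in>{None, Some 0, Some 1}. schur_class_poly M V v t * g t)"
    by (intro sum.cong refl) (simp add: schur_class_poly_def sum_distrib_right)
  finally show ?thesis by (simp add: add.assoc)
qed

lemma graph_twist_poly_eq_sum:
  assumes "finite (vertices G)"
  shows "graph_twist_poly G = (\<Sum>A\<in>Pow (vertices G). rank_weight (adjacency G) (vertices G) A)"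
proof -
  have "fst (delta_matroid G) = vertices G" by (simp add: delta_matroid_def)
  then show ?thesis
    unfolding graph_twist_poly_def twist_poly_def rank_weight_def
    by (simp add: width_twist_delta_matroid[OF assms])
qed

text \<open>In each splitting of \<open>insert v V\<close> into a set and its complement,
  \<open>v\<close> borders exactly one of the two parts. The splittings with \<open>v\<close> on
  either side contribute equally, which gives the factor 2.\<close>

lemma sum_rank_weight_insert:
  assumes sym: "symmetric M" and "finite V" "v \<notin> V"
  shows "(\<Sum>A\<in>Pow (insert v V). rank_weight M (insert v V) A) =
    2 * (\<Sum>A\<in>Pow V. rank_weight M V A * monom 1 (rank_jump (schur M v A)))"
proof -
  have "(\<Sum>A\<in>Pow (insert v V). rank_weight M (insert v V) A) =
    (\<Sum>A\<in>Pow V. rank_weight M (insert v V) A) +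
    (\<Sum>A\<in>insert v ` Pow V. rank_weight M (insert v V) A)"
    unfolding Pow_insert using assms by (intro sum.union_disjoint) auto
  also have "(\<Sum>A\<in>insert v ` Pow V. rank_weight M (insert v V) A) =
    (\<Sum>A\<in>Pow V. rank_weight M (insert v V) (insert v A))"
    using assms(3) by (subst sum.reindex) (auto simp: inj_on_def)
  also have "\<dots> = (\<Sum>A\<in>Pow V. rank_weight M V A * monom 1 (rank_jump (schur M v A)))"
  proof (intro sum.cong refl)
    fix A assume "A \<in> Pow V"
    moreover then have "insert v V - insert v A = V - A" "finite A" "v \<notin> A"
      using assms finite_subset by auto
    ultimately show "rank_weight M (insert v V) (insert v A) =
        rank_weight M V A * monom 1 (rank_jump (schur M v A))"
      by (simp add: rank_weight_def rank_on_insert[OF sym] mult_monom ac_simps)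
  qed
  \<comment> \<open>For sets without \<open>v\<close>, passing to the complement in \<open>V\<close>
    makes \<open>A\<close> the part that \<open>v\<close> borders.\<close>
  also have "(\<Sum>A\<in>Pow V. rank_weight M (insert v V) A) =
    (\<Sum>A\<in>Pow V. rank_weight M (insert v V) (V - A))"
    by (rule sum.reindex_bij_witness[of _ "\<lambda>A. V - A" "\<lambda>A. V - A"]) (auto simp: double_diff)
  also have "\<dots> = (\<Sum>A\<in>Pow V. rank_weight M V A * monom 1 (rank_jump (schur M v A)))"
  proof (intro sum.cong refl)
    fix A assume "A \<in> Pow V"
    moreover then have "insert v V - (V - A) = insert v A" "finite A" "v \<notin> A"
      using assms finite_subset by auto
    ultimately show "rank_weight M (insert v V) (V - A) =
        rank_weight M V A * monom 1 (rank_jump (schur M v A))"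
      by (simp add: rank_weight_def rank_on_insert[OF sym] mult_monom ac_simps)
  qed
  finally show ?thesis by simp
qed

lemma rank_weight_cong:
  assumes "\<And>i j. i \<in> V \<Longrightarrow> j \<in> V \<Longrightarrow> M i j = N i j" "A \<subseteq> V"
  shows "rank_weight M V A = rank_weight N V A"
proof -
  have "rank_on M A = rank_on N A" "rank_on M (V - A) = rank_on N (V - A)"
    using assms by (auto intro!: rank_on_cong)
  then show ?thesis by (simp add: rank_weight_def)
qed

text \<open>Toggling the loop changes only the diagonal entry at \<open>v\<close>: the same vectors
  \<open>y\<close> solve the system, and the Schur complement shifts by 1.\<close>

lemma is_schur_loop:
  assumes "\<And>i. i \<in> A \<Longrightarrow> N i v = M i v" "\<And>j. j \<in> A \<Longrightarrow> N v j = M v j"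
    and "\<And>i j. i \<in> A \<Longrightarrow> j \<in> A \<Longrightarrow> N i j = M i j"
    and "N v v = M v v + 1"
  shows "is_schur N v A s \<longleftrightarrow> is_schur M v A (s + 1)"
proof -
  have "(\<Sum>j\<in>A. N i j * y j) = (\<Sum>j\<in>A. M i j * y j)" if "i \<in> insert v A" for i y
    using assms that by (intro sum.cong) auto
  moreover have "s = M v v + 1 + c \<longleftrightarrow> s + 1 = M v v + c" for c
    by (cases s; cases "M v v"; cases c; simp)
  ultimately show ?thesis using assms by (simp add: is_schur_def)
qed

section \<open>One-point joins\<close>

text \<open>Together with \<open>inj_on_Plus\<close> this turns a sum over subsets of the joined
  vertex set into a double sum.\<close>

lemma Pow_Plus: "Pow (A <+> B) = (\<lambda>(X, Y). X <+> Y) ` (Pow A \<times> Pow B)"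
proof
  show "Pow (A <+> B) \<subseteq> (\<lambda>(X, Y). X <+> Y) ` (Pow A \<times> Pow B)"
  proof
    fix C assume C: "C \<in> Pow (A <+> B)"
    then have "C = (Inl -` C) <+> (Inr -` C)" by (auto simp: Plus_def)
    moreover have "Inl -` C \<subseteq> A" "Inr -` C \<subseteq> B" using C by auto
    ultimately show "C \<in> (\<lambda>(X, Y). X <+> Y) ` (Pow A \<times> Pow B)" by blast
  qed
qed auto

lemma inj_on_Plus: "inj_on (\<lambda>(X, Y). X <+> Y) S"
proof (rule inj_onI, clarify)
  fix X X' :: "'a set" and Y Y' :: "'b set"
  assume eq: "X <+> Y = X' <+> Y'"
  have "Inl -` (X <+> Y) = X" "Inr -` (X <+> Y) = Y"
    "Inl -` (X' <+> Y') = X'" "Inr -` (X' <+> Y') = Y'" by auto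
  with eq show "X = X' \<and> Y = Y'" by metis
qed

lemma ball_Plus: "(\<forall>c\<in>A <+> B. P c) \<longleftrightarrow> (\<forall>a\<in>A. P (Inl a)) \<and> (\<forall>b\<in>B. P (Inr b))"
  by auto

lemma all_not_in_Plus:
  "(\<forall>c. c \<notin> A <+> B \<longrightarrow> P c) \<longleftrightarrow> (\<forall>a. a \<notin> A \<longrightarrow> P (Inl a)) \<and> (\<forall>b. b \<notin> B \<longrightarrow> P (Inr b))"
  unfolding split_sum_all by auto

text \<open>The situation at a join with the common vertex taken out: the submatrix on
  \<open>A <+> B\<close> is block diagonal, the second zero block following from symmetry. Off these
  blocks only symmetry is assumed, so the row of the common vertex remains free.\<close>

locale block_form =
  fixes M :: "'a + 'b \<Rightarrow> 'a + 'b \<Rightarrow> bit" and M1 :: "'a \<Rightarrow> 'a \<Rightarrow> bit" and M2 :: "'b \<Rightarrow> 'b \<Rightarrow> bit"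
    and A :: "'a set" and B :: "'b set"
  assumes sym: "symmetric M" "symmetric M1" "symmetric M2"
    and fin: "finite A" "finite B"
    and blocks: "i \<in> A \<Longrightarrow> i' \<in> A \<Longrightarrow> M (Inl i) (Inl i') = M1 i i'"
      "j \<in> B \<Longrightarrow> j' \<in> B \<Longrightarrow> M (Inr j) (Inr j') = M2 j j'"
      "i \<in> A \<Longrightarrow> j \<in> B \<Longrightarrow> M (Inl i) (Inr j) = 0"
begin

lemma row_Inl:
  "i \<in> A \<Longrightarrow> (\<Sum>c\<in>A <+> B. M (Inl i) c * z c) = (\<Sum>j\<in>A. M1 i j * z (Inl j))"
  by (simp add: sum.Plus[OF fin] blocks)

lemma row_Inr:
  "i \<in> B \<Longrightarrow> (\<Sum>c\<in>A <+> B. M (Inr i) c * z c) = (\<Sum>j\<in>B. M2 i j * z (Inr j))"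
  by (simp add: sum.Plus[OF fin] blocks symmetricD[OF sym(1), of "Inr i" "Inl j" for j])

text \<open>The kernel of a block diagonal matrix is the product of the two kernels, so
  cardinalities multiply and nullities add.\<close>

lemma rank_on_Plus: "rank_on M (A <+> B) = rank_on M1 A + rank_on M2 B"
proof -
  have iff: "z \<in> kernel_on M (A <+> B) \<longleftrightarrow> z \<circ> Inl \<in> kernel_on M1 A \<and> z \<circ> Inr \<in> kernel_on M2 B" for z
    by (auto simp: kernel_on_def ball_Plus all_not_in_Plus row_Inl row_Inr)
  have eta: "case_sum (z \<circ> Inl) (z \<circ> Inr) = z" for z :: "'a + 'b \<Rightarrow> bit"
    by (auto simp: fun_eq_iff split: sum.split)
  have "bij_betw (\<lambda>z. (z \<circ> Inl, z \<circ> Inr)) (kernel_on M (A <+> B)) (kernel_on M1 A \<times> kernel_on M2 B)"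
    by (rule bij_betw_byWitness[where f' = "\<lambda>(x, y). case_sum x y"])
      (auto simp: iff eta case_sum_o_inj)
  then have "card (kernel_on M (A <+> B)) = card (kernel_on M1 A) * card (kernel_on M2 B)"
    by (simp add: bij_betw_same_card card_cartesian_product)
  also have "\<dots> = 2 ^ (nullity_on M1 A + nullity_on M2 B)"
    using card_kernel_on[OF sym(2) fin(1)] card_kernel_on[OF sym(3) fin(2)] by (simp add: power_add)
  finally have "nullity_on M (A <+> B) = nullity_on M1 A + nullity_on M2 B"
    by (rule nullity_onI)
  then show ?thesis
    using nullity_on_le_card[OF sym(2) fin(1)] nullity_on_le_card[OF sym(3) fin(2)] fin
    by (simp add: rank_on_def card_Plus)
qed

text \<open>The system for the bordering column splits into one system per block, and its solutions
  are pairs of solutions. With diagonal entry \<open>M1 v v + M2 w w\<close> the Schur complements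
  add, and one unsolvable block makes the whole system unsolvable.\<close>

lemma schur_Plus:
  assumes v: "M (Inl v) (Inl v) = M1 v v + M2 w w"
    "\<And>i. i \<in> A \<Longrightarrow> M (Inl v) (Inl i) = M1 v i" "\<And>j. j \<in> B \<Longrightarrow> M (Inl v) (Inr j) = M2 w j"
  shows "schur M (Inl v) (A <+> B) =
    Option.bind (schur M1 v A) (\<lambda>s. map_option ((+) s) (schur M2 w B))"
proof -
  have col1: "M (Inl i) (Inl v) = M1 i v" if "i \<in> A" for i
    using v(2)[OF that] symmetricD[OF sym(1)] symmetricD[OF sym(2)] by metis
  have col2: "M (Inr j) (Inl v) = M2 j w" if "j \<in> B" for j
    using v(3)[OF that] symmetricD[OF sym(1)] symmetricD[OF sym(3)] by metis
  have rowv: "(\<Sum>c\<in>A <+> B. M (Inl v) c * z c) =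
      (\<Sum>j\<in>A. M1 v j * z (Inl j)) + (\<Sum>j\<in>B. M2 w j * z (Inr j))" for z
    by (simp add: sum.Plus[OF fin] v)
  have iff: "is_schur M (Inl v) (A <+> B) s \<longleftrightarrow>
      (\<exists>s1 s2. is_schur M1 v A s1 \<and> is_schur M2 w B s2 \<and> s = s1 + s2)" for s
  proof
    assume "is_schur M (Inl v) (A <+> B) s"
    then obtain z where z: "\<forall>i\<in>A <+> B. (\<Sum>j\<in>A <+> B. M i j * z j) = M i (Inl v)"
      "s = M (Inl v) (Inl v) + (\<Sum>j\<in>A <+> B. M (Inl v) j * z j)"
      unfolding is_schur_def by blast
    have "is_schur M1 v A (M1 v v + (\<Sum>j\<in>A. M1 v j * z (Inl j)))"
      unfolding is_schur_def
      using z(1) by (intro exI[of _ "z \<circ> Inl"]) (auto simp: ball_Plus row_Inl col1)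
    moreover have "is_schur M2 w B (M2 w w + (\<Sum>j\<in>B. M2 w j * z (Inr j)))"
      unfolding is_schur_def
      using z(1) by (intro exI[of _ "z \<circ> Inr"]) (auto simp: ball_Plus row_Inr col2)
    ultimately show "\<exists>s1 s2. is_schur M1 v A s1 \<and> is_schur M2 w B s2 \<and> s = s1 + s2"
      using z(2) by (intro exI conjI) (assumption, assumption, simp add: rowv v(1) add.assoc add.left_commute)
  next
    assume "\<exists>s1 s2. is_schur M1 v A s1 \<and> is_schur M2 w B s2 \<and> s = s1 + s2"
    then obtain x y where x: "\<forall>i\<in>A. (\<Sum>j\<in>A. M1 i j * x j) = M1 i v"
      and y: "\<forall>i\<in>B. (\<Sum>j\<in>B. M2 i j * y j) = M2 i w"
      and s: "s = (M1 v v + (\<Sum>j\<in>A. M1 v j * x j)) + (M2 w w + (\<Sum>j\<in>B. M2 w j * y j))"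
      unfolding is_schur_def by blast
    show "is_schur M (Inl v) (A <+> B) s"
      unfolding is_schur_def
      using x y
      by (intro exI[of _ "case_sum x y"])
        (simp add: ball_Plus row_Inl row_Inr col1 col2 rowv v(1) s add_ac)
  qed
  have "schur M (Inl v) (A <+> B) = Some s \<longleftrightarrow>
      (\<exists>s1 s2. schur M1 v A = Some s1 \<and> schur M2 w B = Some s2 \<and> s = s1 + s2)" for s
    by (simp add: schur_eq_Some_iff sym iff)
  then show ?thesis
    by (cases "schur M1 v A"; cases "schur M2 w B"; cases "schur M (Inl v) (A <+> B)") auto
qed

end

section \<open>Adjacency matrices and twist polynomials of the graph operations\<close>

lemma adjacency_loop_complement:
  "adjacency (loop_complement G v) u w = adjacency G u w + (if u = v \<and> w = v then 1 else 0)"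
  by (auto simp: adjacency_def loop_complement_def)

lemma adjacency_delete_vertex:
  "u \<noteq> v \<Longrightarrow> w \<noteq> v \<Longrightarrow> adjacency (delete_vertex G v) u w = adjacency G u w"
  by (auto simp: adjacency_def delete_vertex_def)

text \<open>The vertex map of \<open>H\<close> is injective, so membership of its edges can be
  pulled back. Between two \<open>Inl\<close> vertices an edge of \<open>H\<close> can only be the
  loop at the common vertex, where it is added in F_2; edges at an \<open>Inr\<close> vertex come
  from \<open>H\<close> alone. The exclusion of \<open>w\<close> reflects that \<open>w\<close> is
  represented by \<open>Inl v\<close>.\<close>

lemma adjacency_one_point_join:
  fixes G :: "'a graph" and H :: "'b graph"
  shows "adjacency (one_point_join G v H w) (Inl a) (Inl a') =
      adjacency G a a' + (if a = v \<and> a' = v then adjacency H w w else 0)"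
    and "b \<noteq> w \<Longrightarrow> adjacency (one_point_join G v H w) (Inl a) (Inr b) =
      (if a = v then adjacency H w b else 0)"
    and "b \<noteq> w \<Longrightarrow> b' \<noteq> w \<Longrightarrow>
      adjacency (one_point_join G v H w) (Inr b) (Inr b') = adjacency H b b'"
proof -
  let ?\<iota> = "\<lambda>y. if y = w then Inl v else Inr y"
  have "inj ?\<iota>" by (rule injI) (auto split: if_splits)
  then have inj: "inj ((`) ?\<iota>)" by (intro injI) (simp only: inj_image_eq_iff)
  have injl: "inj ((`) (Inl :: 'a \<Rightarrow> 'a + 'b))"
    by (intro injI) (simp only: inj_image_eq_iff[OF inj_Inl])
  have \<iota>: "?\<iota> ` {x, y} \<in> (`) ?\<iota> ` edges H \<longleftrightarrow> {x, y} \<in> edges H" for x y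
    by (rule inj_image_mem_iff[OF inj])
  have l: "(Inl :: 'a \<Rightarrow> 'a + 'b) ` {x, y} \<in> (`) Inl ` edges G \<longleftrightarrow> {x, y} \<in> edges G" for x y
    by (rule inj_image_mem_iff[OF injl])
  have l2: "{Inl a, Inl a' :: 'a + 'b} \<in> (`) Inl ` edges G \<longleftrightarrow> {a, a'} \<in> edges G" for a a'
    using l[of a a'] by simp
  have ll: "{Inl a, Inl a'} \<in> (`) ?\<iota> ` edges H \<longleftrightarrow> a = v \<and> a' = v \<and> {w, w} \<in> edges H" for a a'
  proof (cases "a = v \<and> a' = v")
    case True
    then show ?thesis using \<iota>[of w w] by simp
  next
    case False
    then show ?thesis by (auto dest: equalityD1 split: if_splits)
  qed
  have r: "{c, Inr b :: 'a + 'b} \<notin> (`) Inl ` edges G" for c b by auto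
  have lr: "{Inl a, Inr b} \<in> (`) ?\<iota> ` edges H \<longleftrightarrow> a = v \<and> {w, b} \<in> edges H" if "b \<noteq> w" for a b
  proof (cases "a = v")
    case True
    then show ?thesis using \<iota>[of w b] that by (simp add: insert_commute[of "Inr b"])
  next
    case False
    then show ?thesis by (auto dest: equalityD1 split: if_splits)
  qed
  have rr: "{Inr b, Inr b'} \<in> (`) ?\<iota> ` edges H \<longleftrightarrow> {b, b'} \<in> edges H" if "b \<noteq> w" "b' \<noteq> w" for b b'
    using \<iota>[of b b'] that by simp
  note E = one_point_join_def Let_def adjacency_def graph.select_convs Un_iff Diff_iff
  show "adjacency (one_point_join G v H w) (Inl a) (Inl a') =
      adjacency G a a' + (if a = v \<and> a' = v then adjacency H w w else 0)"
    unfolding E l2 ll by auto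
  show "adjacency (one_point_join G v H w) (Inl a) (Inr b) =
      (if a = v then adjacency H w b else 0)" if "b \<noteq> w"
    unfolding E lr[OF that] using r by auto
  show "adjacency (one_point_join G v H w) (Inr b) (Inr b') = adjacency H b b'" if "b \<noteq> w" "b' \<noteq> w"
    unfolding E rr[OF that] using r by auto
qed

lemma vertices_one_point_join:
  assumes "v \<in> vertices G" "w \<in> vertices H"
  shows "vertices (one_point_join G v H w) =
    insert (Inl v) ((vertices G - {v}) <+> (vertices H - {w}))"
  using assms by (auto simp: one_point_join_def)

lemma graph_twist_poly_vertex:
  assumes "finite V" "v \<notin> V" "vertices G = insert v V"
  shows "graph_twist_poly G =
    2 * (schur_class_poly (adjacency G) V v None * [:0, 1:]\<^sup>2 +
         schur_class_poly (adjacency G) V v (Some 0) +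
         schur_class_poly (adjacency G) V v (Some 1) * [:0, 1:])"
proof -
  have "graph_twist_poly G = 2 * (\<Sum>A\<in>Pow V. rank_weight (adjacency G) V A *
      monom 1 (rank_jump (schur (adjacency G) v A)))"
    using assms by (simp add: graph_twist_poly_eq_sum sum_rank_weight_insert[OF symmetric_adjacency])
  then show ?thesis
    unfolding sum_rank_weight_by_schur[OF assms(1), where g = "\<lambda>t. monom 1 (rank_jump t)"]
    by (simp add: rank_jump_def monom_altdef)
qed

text \<open>The ranks inside \<open>V\<close> do not see the loop at \<open>v\<close>, while the
  shift by 1 exchanges the classes \<open>Some 0\<close> and \<open>Some 1\<close> and fixes
  \<open>None\<close>.\<close>

lemma graph_twist_poly_loop_complement:
  assumes "finite V" "v \<notin> V" "vertices G = insert v V"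
  shows "graph_twist_poly (loop_complement G v) =
    2 * (schur_class_poly (adjacency G) V v None * [:0, 1:]\<^sup>2 +
         schur_class_poly (adjacency G) V v (Some 1) +
         schur_class_poly (adjacency G) V v (Some 0) * [:0, 1:])"
proof -
  let ?M = "adjacency G" and ?N = "adjacency (loop_complement G v)"
  have schur: "schur ?N v A = t \<longleftrightarrow> schur ?M v A = map_option ((+) 1) t" if "A \<subseteq> V" for A t
  proof -
    have "is_schur ?N v A s \<longleftrightarrow> is_schur ?M v A (s + 1)" for s
      using assms(2) that by (intro is_schur_loop) (auto simp: adjacency_loop_complement)
    from this[of 0] this[of 1] show ?thesis
      using is_schur_unique[OF symmetric_adjacency[of G], of v A 0 1]
      by (cases t) (auto simp: schur_def)
  qed
  have cls: "schur_class_poly ?N V v t = schur_class_poly ?M V v (map_option ((+) 1) t)" for t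
    unfolding schur_class_poly_def
  proof (rule sum.cong)
    fix A assume "A \<in> {A. A \<in> Pow V \<and> schur ?M v A = map_option ((+) 1) t}"
    then show "rank_weight ?N V A = rank_weight ?M V A"
      using assms(2) by (intro rank_weight_cong) (auto simp: adjacency_loop_complement)
  qed (intro Collect_cong conj_cong refl, simp add: schur)
  have "vertices (loop_complement G v) = insert v V"
    using assms(3) by (simp add: loop_complement_def)
  from graph_twist_poly_vertex[OF assms(1,2) this] show ?thesis
    by (simp add: cls)
qed

lemma graph_twist_poly_delete_vertex:
  assumes "finite V" "v \<notin> V" "vertices G = insert v V"
  shows "graph_twist_poly (delete_vertex G v) =
    schur_class_poly (adjacency G) V v None + schur_class_poly (adjacency G) V v (Some 0) +
    schur_class_poly (adjacency G) V v (Some 1)"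
proof -
  have V: "vertices (delete_vertex G v) = V"
    using assms by (auto simp: delete_vertex_def)
  have "graph_twist_poly (delete_vertex G v) = (\<Sum>A\<in>Pow V. rank_weight (adjacency G) V A)"
    unfolding graph_twist_poly_eq_sum[of "delete_vertex G v", unfolded V, OF assms(1)]
    using assms(2)
    by (intro sum.cong refl rank_weight_cong) (auto intro!: adjacency_delete_vertex)
  then show ?thesis
    using sum_rank_weight_by_schur[OF assms(1), of "adjacency G" "\<lambda>_. 1" v] by simp
qed

text \<open>Pairs of Schur classes contribute \<open>z^2\<close> if either is \<open>None\<close>;
  otherwise they contribute 1 for equal values and \<open>z\<close> for different ones, because the
  values add in F_2.\<close>

lemma graph_twist_poly_one_point_join:
  assumes V: "finite V" "v \<notin> V" "vertices G = insert v V"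
    and W: "finite W" "w \<notin> W" "vertices H = insert w W"
  defines "P \<equiv> schur_class_poly (adjacency G) V v"
    and "Q \<equiv> schur_class_poly (adjacency H) W w"
  shows "graph_twist_poly (one_point_join G v H w) =
    2 * ((P None * (Q None + Q (Some 0) + Q (Some 1)) +
          (P (Some 0) + P (Some 1)) * Q None) * [:0, 1:]\<^sup>2 +
         (P (Some 0) * Q (Some 0) + P (Some 1) * Q (Some 1)) +
         (P (Some 0) * Q (Some 1) + P (Some 1) * Q (Some 0)) * [:0, 1:])"
proof -
  let ?J = "one_point_join G v H w"
  let ?M = "adjacency ?J" and ?M1 = "adjacency G" and ?M2 = "adjacency H"
  define g :: "bit option \<Rightarrow> int poly" where "g t = monom 1 (rank_jump t)" for t
  \<comment> \<open>Addition in F_2 with \<open>None\<close> absorbing, as in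
    \<open>schur_Plus\<close>.\<close>
  define join where "join s t = Option.bind s (\<lambda>a. map_option ((+) a) t)" for s t :: "bit option"
  have VJ: "vertices ?J = insert (Inl v) (V <+> W)"
    using V W by (subst vertices_one_point_join) auto
  have fin: "finite (V <+> W)" "Inl v \<notin> V <+> W" using V W by auto
  have block: "block_form ?M ?M1 ?M2 A B" if "A \<subseteq> V" "B \<subseteq> W" for A B
  proof -
    have "finite A" "finite B" using that V W finite_subset by blast+
    moreover have "i \<noteq> v" if "i \<in> A" for i using that \<open>A \<subseteq> V\<close> V(2) by blast
    moreover have "j \<noteq> w" if "j \<in> B" for j using that \<open>B \<subseteq> W\<close> W(2) by blast
    ultimately show ?thesis
      by unfold_locales (simp_all add: symmetric_adjacency adjacency_one_point_join)
  qed
  have summand: "rank_weight ?M (V <+> W) (A <+> B) * g (schur ?M (Inl v) (A <+> B)) =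
      rank_weight ?M1 V A * (rank_weight ?M2 W B * g (join (schur ?M1 v A) (schur ?M2 w B)))"
    if "A \<in> Pow V" "B \<in> Pow W" for A B
  proof -
    have sub: "A \<subseteq> V" "B \<subseteq> W" using that by auto
    have "(V <+> W) - (A <+> B) = (V - A) <+> (W - B)" by auto
    then have "rank_weight ?M (V <+> W) (A <+> B) = rank_weight ?M1 V A * rank_weight ?M2 W B"
      using block_form.rank_on_Plus[OF block[OF sub]] block_form.rank_on_Plus[OF block, of "V - A" "W - B"]
      by (simp add: rank_weight_def mult_monom ac_simps)
    moreover have "schur ?M (Inl v) (A <+> B) = join (schur ?M1 v A) (schur ?M2 w B)"
      unfolding join_def
    proof (rule block_form.schur_Plus[OF block[OF sub]])
      show "?M (Inl v) (Inl i) = ?M1 v i" if "i \<in> A" for i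
        using that sub V(2) by (auto simp: adjacency_one_point_join)
      show "?M (Inl v) (Inr j) = ?M2 w j" if "j \<in> B" for j
      proof -
        have "j \<noteq> w" using that sub W(2) by blast
        then show ?thesis by (simp add: adjacency_one_point_join)
      qed
    qed (simp add: adjacency_one_point_join)
    ultimately show ?thesis by (simp add: mult.assoc)
  qed
  have "graph_twist_poly ?J =
      2 * (\<Sum>C\<in>Pow (V <+> W). rank_weight ?M (V <+> W) C * g (schur ?M (Inl v) C))"
    using fin by (simp add: graph_twist_poly_eq_sum VJ sum_rank_weight_insert[OF symmetric_adjacency] g_def)
  also have "(\<Sum>C\<in>Pow (V <+> W). rank_weight ?M (V <+> W) C * g (schur ?M (Inl v) C)) =
      (\<Sum>(A, B)\<in>Pow V \<times> Pow W. rank_weight ?M (V <+> W) (A <+> B) * g (schur ?M (Inl v) (A <+> B)))"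
    unfolding Pow_Plus by (subst sum.reindex[OF inj_on_Plus]) (simp add: case_prod_beta)
  also have "\<dots> = (\<Sum>A\<in>Pow V. \<Sum>B\<in>Pow W.
      rank_weight ?M (V <+> W) (A <+> B) * g (schur ?M (Inl v) (A <+> B)))"
    by (rule sum.cartesian_product[symmetric])
  also have "\<dots> = (\<Sum>A\<in>Pow V. rank_weight ?M1 V A *
      (\<Sum>B\<in>Pow W. rank_weight ?M2 W B * g (join (schur ?M1 v A) (schur ?M2 w B))))"
    unfolding sum_distrib_left using summand by (intro sum.cong refl)
  \<comment> \<open>The inner sum is grouped by the class of \<open>B\<close> for a fixed class
    \<open>s\<close> of \<open>A\<close>. The result is a function of \<open>s\<close>, so the outer
    sum can be grouped in the same way.\<close>
  also have "\<dots> = (\<Sum>A\<in>Pow V. rank_weight ?M1 V A *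
      (\<lambda>s. Q None * g (join s None) + Q (Some 0) * g (join s (Some 0)) + Q (Some 1) * g (join s (Some 1)))
        (schur ?M1 v A))"
    unfolding Q_def by (simp add: sum_rank_weight_by_schur[OF W(1), where g = "\<lambda>t. g (join s t)" for s])
  also have "\<dots> = P None * (Q None * g None + Q (Some 0) * g None + Q (Some 1) * g None) +
      P (Some 0) * (Q None * g None + Q (Some 0) * g (Some 0) + Q (Some 1) * g (Some 1)) +
      P (Some 1) * (Q None * g None + Q (Some 0) * g (Some 1) + Q (Some 1) * g (Some 0))"
    unfolding P_def by (subst sum_rank_weight_by_schur[OF V(1)]) (simp add: join_def)
  finally show ?thesis
    by (simp add: g_def rank_jump_def monom_altdef algebra_simps)
qed

theorem theorem1p4:
  fixes G1 :: "'a graph" and G2 :: "'b graph" and v1 :: 'a and v2 :: 'b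
  assumes "looped_simple_graph G1" and "looped_simple_graph G2"
    and "v1 \<in> vertices G1" and "v2 \<in> vertices G2"
    and "looped G1 v1 \<longleftrightarrow> looped G2 v2"
  shows "let z = [:0, 1:] :: int poly in
    (4 * z^2 - 2 * z - 2) * graph_twist_poly (one_point_join G1 v1 G2 v2) =
      vec_of_list [graph_twist_poly G1,
                   graph_twist_poly (loop_complement G1 v1),
                   graph_twist_poly (delete_vertex G1 v1)]
      \<bullet> (mat_of_rows_list 3
            [[- (z + 1), z, 2 * z^2],
             [z, - (z + 1), 2 * z^2],
             [2 * z^2, 2 * z^2, - 4 * z^2 * (z + 1)]]
          *\<^sub>v vec_of_list [graph_twist_poly G2,
                           graph_twist_poly (loop_complement G2 v2),
                           graph_twist_poly (delete_vertex G2 v2)])"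
proof -
  define V where "V = vertices G1 - {v1}"
  define W where "W = vertices G2 - {v2}"
  have V: "finite V" "v1 \<notin> V" "vertices G1 = insert v1 V"
    using assms(1,3) by (auto simp: V_def looped_simple_graph_def)
  have W: "finite W" "v2 \<notin> W" "vertices G2 = insert v2 W"
    using assms(2,4) by (auto simp: W_def looped_simple_graph_def)
  have bilinear: "vec_of_list [x1, x2, x3] \<bullet> (mat_of_rows_list 3
        [[a11, a12, a13], [a21, a22, a23], [a31, a32, a33]] *\<^sub>v vec_of_list [y1, y2, y3]) =
      x1 * (a11 * y1 + a12 * y2 + a13 * y3) + x2 * (a21 * y1 + a22 * y2 + a23 * y3) +
      x3 * (a31 * y1 + a32 * y2 + a33 * y3)"
    for x1 x2 x3 y1 y2 y3 a11 a12 a13 a21 a22 a23 a31 a32 a33 :: "int poly"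
    by (simp add: scalar_prod_def mat_of_rows_list_def row_def numeral_3_eq_3 vec_of_list_index
        algebra_simps)
  \<comment> \<open>The three twist polynomials of a graph are linear in its classes, with
    determinant \<open>2 * (z - 1) * (4 * z^2 - 2 * z - 2)\<close>. The factor on the left clears
    the denominators that arise when the bilinear form in the classes is rewritten in twist
    polynomials.\<close>
  have identity: "(4 * z^2 - 2 * z - 2) * (2 * ((p * (q + q0 + q1) + (p0 + p1) * q) * z^2 +
        (p0 * q0 + p1 * q1) + (p0 * q1 + p1 * q0) * z)) =
      2 * (p * z^2 + p0 + p1 * z) * (- (z + 1) * (2 * (q * z^2 + q0 + q1 * z)) +
        z * (2 * (q * z^2 + q1 + q0 * z)) + 2 * z^2 * (q + q0 + q1)) +
      2 * (p * z^2 + p1 + p0 * z) * (z * (2 * (q * z^2 + q0 + q1 * z)) +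
        - (z + 1) * (2 * (q * z^2 + q1 + q0 * z)) + 2 * z^2 * (q + q0 + q1)) +
      (p + p0 + p1) * (2 * z^2 * (2 * (q * z^2 + q0 + q1 * z)) +
        2 * z^2 * (2 * (q * z^2 + q1 + q0 * z)) + - 4 * z^2 * (z + 1) * (q + q0 + q1))"
    for z p p0 p1 q q0 q1 :: "int poly"
    by (simp add: algebra_simps power2_eq_square)
  show ?thesis
    unfolding Let_def bilinear
      graph_twist_poly_vertex[OF V] graph_twist_poly_loop_complement[OF V]
      graph_twist_poly_delete_vertex[OF V]
      graph_twist_poly_vertex[OF W] graph_twist_poly_loop_complement[OF W]
      graph_twist_poly_delete_vertex[OF W] graph_twist_poly_one_point_join[OF V W]
    by (rule identity)
qed

end
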